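(* Let $r\in\{0,1,2\}$ and let $k\ge 3$ be an integer, with $k\ge 4$ when $r=2$. Then the polynomial $H_{k,r}(x)=G_k(x)F_{k+r}(x)$ is unimodal and has a mode at $$m_{k,r}:=\left\lfloor\frac{4k+2r+8}{3}\right\rfloor .$$
   Context: For an integer $t\ge 0$ put $F_t(x)=(1+2x)^t+x(1+x)^t$. For $k\ge 1$ put $G_k(x)=F_4(x)(1+2x)^{k-1}+x(1+x)^kF_3(x)$ (this equals the independence polynomial of the tree $T_{3,k-1,0}$). A polynomial with nonnegative coefficients $(a_0,\dots,a_d)$ is unimodal with a mode at $m$ if $a_0\le\cdots\le a_m\ge a_{m+1}\ge\cdots\ge a_d$. *)

theory Defs
  imports "HOL-Computational_Algebra.Polynomial"
begin

definition F :: "nat \<Rightarrow> int poly" where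
  "F t = [:1, 2:] ^ t + [:0, 1:] * [:1, 1:] ^ t"

text \<open>Only meaningful for \<open>k \<ge> 1\<close>, because of the truncated subtraction \<open>k - 1\<close>.\<close>

definition G :: "nat \<Rightarrow> int poly" where
  "G k = F 4 * [:1, 2:] ^ (k - 1) + [:0, 1:] * [:1, 1:] ^ k * F 3"

definition H :: "nat \<Rightarrow> nat \<Rightarrow> int poly" where
  "H k r = G k * F (k + r)"

text \<open>The coefficient sequence is \<open>a\<^sub>0, \<dots>, a\<^sub>d\<close> with \<open>d\<close> the degree, and the mode is one of
  the indices \<open>0, \<dots>, d\<close>. Modes need not be unique.\<close>

definition unimodal_with_mode :: "'a::linordered_idom poly \<Rightarrow> nat \<Rightarrow> bool" where
  "unimodal_with_mode p m \<longleftrightarrow>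
     (\<forall>i. 0 \<le> coeff p i) \<and>
     m \<le> degree p \<and>
     (\<forall>i<m. coeff p i \<le> coeff p (Suc i)) \<and>
     (\<forall>i. m \<le> i \<and> i < degree p \<longrightarrow> coeff p (Suc i) \<le> coeff p i)"

end

(* Write L = 1 + x and M = 1 + 2x. Multiplying out, H is the sum of M^N with N = 2k + r + 3, of
   x L^4 M^(N-4), and of six terms x^e L^a M^(N-a) with e in {1, 2, 3} and a >= k. The mode of M^N is
   the claimed one, and the second term moves it by too little to matter. Averaging
   2 L = 1 + M and splitting M = L + x show that L^a M^b increases up to (a + b)/2 and
   decreases from 2(a + b)/3 on; from (a + b)/2 on its coefficients are at most (3/4)^a times
   those of M^(a+b). So each of the six terms either moves in the right direction or is
   smaller by a factor (3/4)^k than M^N, whereas the increments of the first two terms are of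
   relative size at least 1/i at index i. This settles k >= 29; the remaining cases are
   computed. *)

theory Submission
  imports Defs
begin

section \<open>Coefficients of \<open>L ^ a * M ^ b\<close> and their recurrences\<close>

abbreviation L :: "int poly" where "L \<equiv> [:1, 1:]"
abbreviation M :: "int poly" where "M \<equiv> [:1, 2:]"

lemma coeff_M_mult: "coeff (M * p) i = coeff p i + (if i = 0 then 0 else 2 * coeff p (i - 1))"
  by (cases i) (auto simp: coeff_pCons)

lemma coeff_L_mult: "coeff (L * p) i = coeff p i + (if i = 0 then 0 else coeff p (i - 1))"
  by (cases i) (auto simp: coeff_pCons)

definition bcoeff :: "nat \<Rightarrow> nat \<Rightarrow> real" where "bcoeff s j = real (s choose j) * 2 ^ j"

lemma coeff_M_power: "real_of_int (coeff (M ^ s) j) = bcoeff s j"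
proof (induction s arbitrary: j)
  case 0
  then show ?case by (cases j) (auto simp: bcoeff_def)
next
  case (Suc s)
  show ?case
    by (cases j) (auto simp: coeff_M_mult Suc bcoeff_def algebra_simps)
qed

lemma coeff_L_power: "coeff (L ^ s) j = int (s choose j)"
proof (induction s arbitrary: j)
  case 0
  then show ?case by (cases j) auto
next
  case (Suc s)
  show ?case
    by (cases j) (auto simp: coeff_L_mult Suc algebra_simps)
qed

definition mcoeff :: "nat \<Rightarrow> nat \<Rightarrow> nat \<Rightarrow> real" where
  "mcoeff a b j = real_of_int (coeff (L ^ a * M ^ b) j)"

lemma mcoeff_0: "mcoeff 0 b j = bcoeff b j"
  by (simp add: mcoeff_def coeff_M_power)

lemma mcoeff_Suc_right:
  "mcoeff a (Suc b) i = mcoeff a b i + (if i = 0 then 0 else 2 * mcoeff a b (i - 1))"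
proof -
  have "L ^ a * M ^ Suc b = M * (L ^ a * M ^ b)" by (simp only: power_Suc mult_ac)
  then show ?thesis unfolding mcoeff_def by (simp only: coeff_M_mult) simp
qed

lemma mcoeff_Suc_left:
  "mcoeff (Suc a) b i = mcoeff a b i + (if i = 0 then 0 else mcoeff a b (i - 1))"
proof -
  have "L ^ Suc a * M ^ b = L * (L ^ a * M ^ b)" by (simp only: power_Suc mult_ac)
  then show ?thesis unfolding mcoeff_def by (simp only: coeff_L_mult) simp
qed

text \<open>This is 2 L = 1 + M. It trades a factor \<open>L\<close> for factors \<open>M\<close>,
  so an estimate for all \<open>a\<close> and \<open>b\<close> follows by induction on
  \<open>a\<close> from the explicit case \<open>a = 0\<close>.\<close>

lemma mcoeff_Suc_average: "2 * mcoeff (Suc a) b i = mcoeff a b i + mcoeff a (Suc b) i"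
  by (simp add: mcoeff_Suc_left mcoeff_Suc_right)

text \<open>This is M = L + x, which serves inductions on \<open>b\<close> down to pure powers of
  \<open>L\<close>.\<close>

lemma mcoeff_Suc_shift:
  "mcoeff a (Suc b) i = mcoeff (Suc a) b i + (if i = 0 then 0 else mcoeff a b (i - 1))"
  by (simp add: mcoeff_Suc_left mcoeff_Suc_right)

lemma mcoeff_nonneg: "0 \<le> mcoeff a b j"
proof (induction a arbitrary: b)
  case 0
  show ?case by (simp add: mcoeff_0 bcoeff_def)
next
  case (Suc a)
  show ?case using Suc[of b] Suc[of "Suc b"] mcoeff_Suc_average[of a b j] by linarith
qed

lemma bcoeff_nonneg: "0 \<le> bcoeff s j"
  by (simp add: bcoeff_def)

section \<open>Ratios of the coefficients of powers of M\<close>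

lemma bcoeff_Suc: "real (Suc j) * bcoeff s (Suc j) = 2 * (real s - real j) * bcoeff s j"
proof (cases "j \<le> s")
  case True
  have "Suc j * (s choose Suc j) = (s - j) * (s choose j)"
    by (simp only: binomial_absorption binomial_absorb_comp)
  then have "real (Suc j) * real (s choose Suc j) = (real s - real j) * real (s choose j)"
    using True by (metis of_nat_diff of_nat_mult)
  then have "real (Suc j) * real (s choose Suc j) * (2 * 2 ^ j) = (real s - real j) * real (s choose j) * (2 * 2 ^ j)"
    by (simp only:)
  then show ?thesis by (simp only: bcoeff_def power_Suc mult_ac)
next
  case False
  then show ?thesis by (simp add: bcoeff_def binomial_eq_0)
qed

lemma bcoeff_lower: "real (Suc s) * bcoeff s j = (real (Suc s) - real j) * bcoeff (Suc s) j"
proof (cases "j \<le> Suc s")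
  case True
  have "Suc s * (s choose j) = (Suc s - j) * (Suc s choose j)"
    using binomial_absorb_comp[of "Suc s" j] by simp
  then have "real (Suc s) * real (s choose j) = (real (Suc s) - real j) * real (Suc s choose j)"
    using True by (metis of_nat_diff of_nat_mult)
  then have "real (Suc s) * real (s choose j) * 2 ^ j = (real (Suc s) - real j) * real (Suc s choose j) * 2 ^ j"
    by (simp only:)
  then show ?thesis by (simp only: bcoeff_def mult_ac)
next
  case False
  then show ?thesis by (simp add: bcoeff_def binomial_eq_0)
qed

text \<open>The sign of 2s - 3j - 1 gives the direction of each step, so \<open>M ^ s\<close> has a
  mode at the ceiling of 2s/3. The factor \<open>Suc j\<close> makes the size of a step explicit as
  well.\<close>

lemma bcoeff_diff: "real (Suc j) * (bcoeff s (Suc j) - bcoeff s j) = (2 * real s - 3 * real j - 1) * bcoeff s j"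
  using bcoeff_Suc[of j s] by (simp add: algebra_simps)

section \<open>Monotonicity and size of the coefficients of \<open>L ^ a * M ^ b\<close>\<close>

lemma mcoeff_up: "2 * j + 1 \<le> a + b \<Longrightarrow> mcoeff a b j \<le> mcoeff a b (Suc j)"
proof (induction b arbitrary: a j)
  case 0
  have "a choose j \<le> a choose Suc j"
  proof (cases "a = Suc (2 * j)")
    \<comment> \<open>The two middle binomial coefficients are equal; \<open>binomial_mono\<close>
      stops just short of this pair.\<close>
    case True
    then show ?thesis using binomial_symmetric[of j a] by simp
  next
    case False
    then show ?thesis using 0 by (intro binomial_mono) auto
  qed
  then show ?case by (simp add: mcoeff_def coeff_L_power)
next
  case (Suc b)
  have "mcoeff (Suc a) b j \<le> mcoeff (Suc a) b (Suc j)"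
    using Suc.prems by (intro Suc.IH) simp
  moreover have "(if j = 0 then 0 else mcoeff a b (j - 1)) \<le> mcoeff a b j"
    using Suc.IH[of "j - 1" a] Suc.prems mcoeff_nonneg by (cases j) auto
  ultimately show ?case by (simp add: mcoeff_Suc_shift)
qed

text \<open>The threshold is that of \<open>M ^ (a + b)\<close>. Averaging leads to products of
  total exponent at most \<open>a + b\<close>, whose thresholds are no larger.\<close>

lemma mcoeff_down: "2 * (a + b) \<le> 3 * j + 1 \<Longrightarrow> mcoeff a b (Suc j) \<le> mcoeff a b j"
proof (induction a arbitrary: b)
  case 0
  then have "real (2 * b) \<le> real (3 * j + 1)"
    unfolding of_nat_le_iff by simp
  then have "real (Suc j) * (bcoeff b (Suc j) - bcoeff b j) \<le> 0"
    unfolding bcoeff_diff by (intro mult_nonpos_nonneg bcoeff_nonneg) simp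
  then show ?case by (simp add: mcoeff_0 mult_le_0_iff)
next
  case (Suc a)
  have "mcoeff a b (Suc j) \<le> mcoeff a b j" "mcoeff a (Suc b) (Suc j) \<le> mcoeff a (Suc b) j"
    using Suc.prems by (auto intro!: Suc.IH)
  then show ?case
    using mcoeff_Suc_average[of a b j] mcoeff_Suc_average[of a b "Suc j"] by linarith
qed

lemma mcoeff_ratio: "a + b < 2 * Suc j \<Longrightarrow> mcoeff a b (Suc j) \<le> 2 * mcoeff a b j"
proof (induction a arbitrary: b)
  case 0
  then have "real b \<le> real (2 * j + 1)"
    unfolding of_nat_le_iff by simp
  then have "2 * (real b - real j) * bcoeff b j \<le> (2 * real (Suc j)) * bcoeff b j"
    by (intro mult_right_mono bcoeff_nonneg) simp
  then have "real (Suc j) * bcoeff b (Suc j) \<le> real (Suc j) * (2 * bcoeff b j)"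
    unfolding bcoeff_Suc by (simp add: algebra_simps)
  then show ?case by (simp add: mcoeff_0)
next
  case (Suc a)
  have "mcoeff a b (Suc j) \<le> 2 * mcoeff a b j" "mcoeff a (Suc b) (Suc j) \<le> 2 * mcoeff a (Suc b) j"
    using Suc.prems by (auto intro!: Suc.IH)
  then show ?case
    using mcoeff_Suc_average[of a b j] mcoeff_Suc_average[of a b "Suc j"] by linarith
qed

text \<open>Exchanging one \<open>M\<close> for \<open>L\<close> costs a factor 3/4: if u and v are
  the coefficients of \<open>L ^ a * M ^ b\<close> at j and j - 1, then u <= 2v gives 4(u + v) <=
  3(u + 2v).\<close>

lemma mcoeff_le_q: "a + b \<le> 2 * j \<Longrightarrow> mcoeff a b j \<le> (3/4) ^ a * bcoeff (a + b) j"
proof (induction a arbitrary: b)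
  case 0
  then show ?case by (simp add: mcoeff_0)
next
  case (Suc a)
  then obtain i where j: "j = Suc i" by (cases j) auto
  have "mcoeff a b j \<le> 2 * mcoeff a b i"
    using Suc.prems j by (intro mcoeff_ratio[of a b i, folded j]) auto
  then have "4 * mcoeff (Suc a) b j \<le> 3 * mcoeff a (Suc b) j"
    by (simp add: mcoeff_Suc_left mcoeff_Suc_right j)
  also have "\<dots> \<le> 3 * ((3/4) ^ a * bcoeff (a + Suc b) j)"
    using Suc.IH[of "Suc b"] Suc.prems by simp
  finally show ?case by simp
qed

section \<open>Expansion of H into eight terms of equal total exponent\<close>

lemma H_decomposition:
  assumes "k \<ge> 1"
  shows "H k r = M ^ (2*k+r+3) + monom 1 1 * (L ^ 4 * M ^ (2*k+r-1)) + 
     monom 1 1 * (L ^ (k+r) * M ^ (k+3)) + monom 1 1 * (L ^ k * M ^ (k+r+3)) +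
     monom 1 2 * (L ^ (k+r+4) * M ^ (k-1)) + monom 1 2 * (L ^ (k+3) * M ^ (k+r)) +
     monom 1 2 * (L ^ (2*k+r) * M ^ 3) + monom 1 3 * (L ^ (2*k+r+3) * M ^ 0)"
proof -
  obtain n where k: "k = Suc n" using assms by (cases k) auto
  have x: "monom 1 e = ([:0, 1:] :: int poly) ^ e" for e by (simp add: monom_altdef)
  have p5: "A ^ 5 = A * A * A * A * A" for A :: "int poly"
    by (simp add: eval_nat_numeral)
  \<comment> \<open>The identity is proved for arbitrary \<open>A\<close>, \<open>B\<close>,
    \<open>x\<close>, so that simplification does not multiply out the concrete linear
    polynomials.\<close>
  have "((A ^ 4 + x * B ^ 4) * A ^ n + x * B ^ Suc n * (A ^ 3 + x * B ^ 3)) * (A ^ (Suc n + r) + x * B ^ (Suc n + r)) =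
     A ^ (2*Suc n+r+3) + x ^ 1 * (B ^ 4 * A ^ (2*n+1+r)) + 
     x ^ 1 * (B ^ (Suc n+r) * A ^ (Suc n+3)) + x ^ 1 * (B ^ Suc n * A ^ (Suc n+r+3)) +
     x ^ 2 * (B ^ (Suc n+r+4) * A ^ n) + x ^ 2 * (B ^ (Suc n+3) * A ^ (Suc n+r)) +
     x ^ 2 * (B ^ (2*Suc n+r) * A ^ 3) + x ^ 3 * (B ^ (2*Suc n+r+3) * A ^ 0)" for A B x :: "int poly"
    by (simp add: power_add power_mult power2_eq_square power3_eq_cube power4_eq_xxxx p5
        mult_2 algebra_simps)
  from this[of M "[:0,1:]" L] show ?thesis
    unfolding H_def G_def F_def k x by simp
qed

text \<open>The coefficient of x^e L^a M^b at \<open>i\<close>. The case distinction is needed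
  because truncated subtraction would yield the constant term for \<open>i < e\<close>.\<close>

definition scoeff :: "nat \<Rightarrow> nat \<Rightarrow> nat \<Rightarrow> nat \<Rightarrow> real" where
  "scoeff e a b i = (if i < e then 0 else mcoeff a b (i - e))"

lemma coeff_monom_L_M: "real_of_int (coeff (monom 1 e * (L ^ a * M ^ b)) i) = scoeff e a b i"
  unfolding coeff_monom_mult scoeff_def mcoeff_def by simp

lemma coeff_H:
  assumes "k \<ge> 1"
  shows "real_of_int (coeff (H k r) i) = bcoeff (2*k+r+3) i + scoeff 1 4 (2*k+r-1) i + scoeff 1 (k+r) (k+3) i +
    scoeff 1 k (k+r+3) i + scoeff 2 (k+r+4) (k-1) i + scoeff 2 (k+3) (k+r) i + scoeff 2 (2*k+r) 3 i + scoeff 3 (2*k+r+3) 0 i"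
  unfolding H_decomposition[OF assms] coeff_add of_int_add coeff_monom_L_M coeff_M_power by (rule refl)

section \<open>Bounds for the six terms with at least k factors L\<close>

lemma bcoeff_mono: "i \<le> j \<Longrightarrow> 3 * j \<le> 2 * N + 2 \<Longrightarrow> bcoeff N i \<le> bcoeff N j"
proof (induction j rule: dec_induct)
  case base
  show ?case by simp
next
  case (step j)
  then have "real (3 * j + 1) \<le> real (2 * N)"
    unfolding of_nat_le_iff by simp
  then have "0 \<le> real (Suc j) * (bcoeff N (Suc j) - bcoeff N j)"
    unfolding bcoeff_diff by (intro mult_nonneg_nonneg bcoeff_nonneg) simp
  then have "bcoeff N j \<le> bcoeff N (Suc j)" by (simp add: zero_le_mult_iff)
  with step show ?case by simp
qed

text \<open>Up to half of \<open>N\<close> the term rises by itself. Beyond that its value at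
  \<open>i\<close> is already below the error, so the value at \<open>Suc i\<close> may be dropped.
  The error is stated at \<open>i - 1\<close> because the increment that will absorb it is bounded
  below at that index.\<close>

lemma scoeff_up:
  assumes "a + b = N" "k \<le> a" "1 \<le> e" "3 * i + 1 \<le> 2 * N"
  shows "scoeff e a b i - (3/4) ^ k * bcoeff N (i - 1) \<le> scoeff e a b (Suc i)"
proof (cases "i < e")
  case True
  then have "scoeff e a b i = 0" "0 \<le> scoeff e a b (Suc i)" by (simp_all add: scoeff_def mcoeff_nonneg)
  moreover have "0 \<le> (3/4) ^ k * bcoeff N (i - 1)" by (simp add: bcoeff_nonneg)
  ultimately show ?thesis by linarith
next
  case False
  define j where "j = i - e"
  have s: "scoeff e a b i = mcoeff a b j" "scoeff e a b (Suc i) = mcoeff a b (Suc j)"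
    using False by (auto simp: scoeff_def j_def Suc_diff_le)
  show ?thesis
  proof (cases "2 * j + 1 \<le> a + b")
    case True
    then have "mcoeff a b j \<le> mcoeff a b (Suc j)" by (rule mcoeff_up)
    moreover have "0 \<le> (3/4) ^ k * bcoeff N (i - 1)" by (simp add: bcoeff_nonneg)
    ultimately show ?thesis unfolding s by linarith
  next
    case False
    then have "mcoeff a b j \<le> (3/4) ^ a * bcoeff N j" using mcoeff_le_q[of a b j] assms(1) by simp
    also have "\<dots> \<le> (3/4) ^ k * bcoeff N (i - 1)"
      using assms by (intro mult_mono power_decreasing bcoeff_mono bcoeff_nonneg) (auto simp: j_def)
    finally show ?thesis unfolding s using mcoeff_nonneg[of a b "Suc j"] by linarith
  qed
qed

lemma bcoeff_near_peak:
  assumes "2 * N \<le> 3 * i" "3 * i \<le> 2 * N + 7" "20 \<le> i"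
  shows "bcoeff N (i - 1) \<le> 4/3 * bcoeff N i" "bcoeff N (i - 2) \<le> 2 * bcoeff N i"
proof -
  define j where "j = i - 2"
  have i: "i = Suc (Suc j)" using assms(3) unfolding j_def by arith
  have N: "3 * real j \<le> 2 * real N + 1"
  proof -
    have "real (3 * i) \<le> real (2 * N + 7)" using assms(2) by (simp only: of_nat_le_iff)
    then show ?thesis by (simp add: i)
  qed
  have j: "18 \<le> real j" using assms(3) by (simp add: i)
  \<comment> \<open>The claim is 8N >= 11i' + 3. For i' = i - 1 the window gives 8N >= 12i' - 16,
    which suffices once i' >= 19; this is where \<open>20 \<le> i\<close> comes from.\<close>
  have "3/4 * bcoeff N i' \<le> bcoeff N (Suc i')" if "i' = j \<or> i' = Suc j" for i'
  proof -
    have "(3/4) * real (Suc i') * bcoeff N i' \<le> real (Suc i') * bcoeff N (Suc i')"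
      unfolding bcoeff_Suc using that N j by (intro mult_right_mono bcoeff_nonneg) auto
    then have "real (Suc i') * (3/4 * bcoeff N i') \<le> real (Suc i') * bcoeff N (Suc i')"
      by (simp only: mult_ac)
    then show ?thesis by (simp only: mult_le_cancel_left_pos of_nat_0_less_iff zero_less_Suc)
  qed
  from this[of j] this[of "Suc j"] have "bcoeff N j \<le> 4/3 * bcoeff N (Suc j)" "bcoeff N (Suc j) \<le> 4/3 * bcoeff N i"
    unfolding i by auto
  then show "bcoeff N (i - 1) \<le> 4/3 * bcoeff N i" "bcoeff N (i - 2) \<le> 2 * bcoeff N i"
    using bcoeff_nonneg[of N i] by (simp_all add: i)
qed

text \<open>A shift by at most 3 delays the descent by at most 3 indices: 3(i - 3) + 1 >= 2N is the
  bound with 8.\<close>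

lemma scoeff_down:
  assumes "a + b = N" "e \<le> 3" "2 * N + 8 \<le> 3 * i" "1 \<le> N"
  shows "scoeff e a b (Suc i) \<le> scoeff e a b i"
proof -
  have "e \<le> i" using assms by linarith
  moreover have "mcoeff a b (Suc (i - e)) \<le> mcoeff a b (i - e)"
    using assms \<open>e \<le> i\<close> by (intro mcoeff_down) auto
  ultimately show ?thesis by (simp add: scoeff_def Suc_diff_le)
qed

text \<open>This covers the indices between the peak of \<open>M ^ N\<close> and the range of
  \<open>scoeff_down\<close>. There the term may still rise, but its new value is itself
  exponentially small against the coefficient of \<open>M ^ N\<close>.\<close>

lemma scoeff_near_peak:
  assumes "a + b = N" "k \<le> a" "1 \<le> e" "e \<le> 3" "2 * N \<le> 3 * i" "3 * i \<le> 2 * N + 7" "20 \<le> i"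
  shows "scoeff e a b (Suc i) \<le> scoeff e a b i + 2 * (3/4) ^ k * bcoeff N i"
proof -
  have "scoeff e a b (Suc i) = mcoeff a b (Suc i - e)" using assms by (simp add: scoeff_def)
  also have "\<dots> \<le> (3/4) ^ a * bcoeff N (Suc i - e)"
    using mcoeff_le_q[of a b "Suc i - e"] assms by simp
  also have "\<dots> \<le> (3/4) ^ k * (2 * bcoeff N i)"
  proof (intro mult_mono power_decreasing)
    have "Suc i - e = i \<or> Suc i - e = i - 1 \<or> Suc i - e = i - 2" using assms by linarith
    then show "bcoeff N (Suc i - e) \<le> 2 * bcoeff N i"
      using bcoeff_near_peak[OF assms(5-7)] bcoeff_nonneg[of N i] by auto
  qed (use assms bcoeff_nonneg in auto)
  finally have "scoeff e a b (Suc i) \<le> 2 * (3/4) ^ k * bcoeff N i" by simp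
  moreover have "0 \<le> scoeff e a b i" by (simp add: scoeff_def mcoeff_nonneg)
  ultimately show ?thesis by linarith
qed

section \<open>The term x L^4 M^(N-4)\<close>

lemma mcoeff_4: "16 * mcoeff 4 b j = bcoeff b j + 4 * bcoeff (b+1) j + 6 * bcoeff (b+2) j + 4 * bcoeff (b+3) j + bcoeff (b+4) j"
  using mcoeff_Suc_average[of 3 b j] mcoeff_Suc_average[of 2 b j] mcoeff_Suc_average[of 2 "b+1" j]
    mcoeff_Suc_average[of 1 b j] mcoeff_Suc_average[of 1 "b+1" j] mcoeff_Suc_average[of 1 "b+2" j]
    mcoeff_Suc_average[of 0 b j] mcoeff_Suc_average[of 0 "b+1" j] mcoeff_Suc_average[of 0 "b+2" j] mcoeff_Suc_average[of 0 "b+3" j]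
  by (simp add: mcoeff_0 numeral_eq_Suc)

text \<open>Expand 16 L^4 = (1 + M)^4 and apply \<open>bcoeff_diff\<close> to each power of
  \<open>M\<close>. \<open>D\<close> belongs to \<open>M ^ (b + 4)\<close> at \<open>Suc j\<close>,
  the index in H once the factor x is counted; the summands at \<open>j\<close> therefore carry
  \<open>D + 3\<close>, \<open>D + 1\<close> and so on.\<close>

lemma mcoeff_4_diff:
  assumes "D = 2 * real (b + 4) - 3 * real (Suc j) - 1"
  shows "16 * (real (Suc j) * (mcoeff 4 b (Suc j) - mcoeff 4 b j)) =
    (D-5) * bcoeff b j + 4 * (D-3) * bcoeff (b+1) j + 6 * (D-1) * bcoeff (b+2) j + 4 * (D+1) * bcoeff (b+3) j + (D+3) * bcoeff (b+4) j"
proof -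
  have "16 * (real (Suc j) * (mcoeff 4 b (Suc j) - mcoeff 4 b j)) = real (Suc j) * (16 * mcoeff 4 b (Suc j) - 16 * mcoeff 4 b j)"
    by (simp add: algebra_simps)
  also have "\<dots> = real (Suc j) * (bcoeff b (Suc j) - bcoeff b j) + 4 * (real (Suc j) * (bcoeff (b+1) (Suc j) - bcoeff (b+1) j))
      + 6 * (real (Suc j) * (bcoeff (b+2) (Suc j) - bcoeff (b+2) j)) + 4 * (real (Suc j) * (bcoeff (b+3) (Suc j) - bcoeff (b+3) j))
      + real (Suc j) * (bcoeff (b+4) (Suc j) - bcoeff (b+4) j)"
    unfolding mcoeff_4 by (simp add: algebra_simps)
  also have "\<dots> = (D-5) * bcoeff b j + 4 * (D-3) * bcoeff (b+1) j + 6 * (D-1) * bcoeff (b+2) j + 4 * (D+1) * bcoeff (b+3) j + (D+3) * bcoeff (b+4) j"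
    unfolding bcoeff_diff assms by (simp add: algebra_simps)
  finally show ?thesis .
qed

lemma bcoeff_half: "Suc t \<le> 2 * j \<Longrightarrow> 2 * bcoeff t j \<le> bcoeff (Suc t) j"
proof -
  assume "Suc t \<le> 2 * j"
  then have "real (Suc t) \<le> real (2 * j)" by (simp only: of_nat_le_iff)
  then have "2 * (real (Suc t) - real j) * bcoeff (Suc t) j \<le> real (Suc t) * bcoeff (Suc t) j"
    by (intro mult_right_mono bcoeff_nonneg) simp
  then have "real (Suc t) * (2 * bcoeff t j) \<le> real (Suc t) * bcoeff (Suc t) j"
    using bcoeff_lower[of t j] by (simp add: algebra_simps)
  then show ?thesis by (simp only: mult_le_cancel_left_pos of_nat_0_less_iff zero_less_Suc)
qed

lemma mcoeff_4_up:
  assumes "3 * Suc j + 1 \<le> 2 * (b + 4)" "12 \<le> b"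
  shows "bcoeff (b+4) j \<le> 16 * (real (Suc j) * (mcoeff 4 b (Suc j) - mcoeff 4 b j))"
proof -
  define d where "d = 2 * (b + 4) - (3 * Suc j + 1)"
  have D: "real d = 2 * real (b + 4) - 3 * real (Suc j) - 1"
    unfolding d_def of_nat_diff[OF assms(1)] by simp
  note nonneg = bcoeff_nonneg[of b j] bcoeff_nonneg[of "b+1" j] bcoeff_nonneg[of "b+2" j] bcoeff_nonneg[of "b+3" j] bcoeff_nonneg[of "b+4" j]
  show ?thesis
  proof (cases "5 \<le> d")
    case True
    then have "0 \<le> (real d-5) * bcoeff b j" "0 \<le> 4 * (real d-3) * bcoeff (b+1) j"
      "0 \<le> 6 * (real d-1) * bcoeff (b+2) j" "0 \<le> 4 * (real d+1) * bcoeff (b+3) j" "bcoeff (b+4) j \<le> (real d+3) * bcoeff (b+4) j"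
      using nonneg by (auto intro!: mult_nonneg_nonneg simp: mult_le_cancel_right1)
    then show ?thesis unfolding mcoeff_4_diff[OF D] by linarith
  next
    case False
    then have "2 * b \<le> 3 * j" unfolding d_def by simp
    \<comment> \<open>Here 2j >= 4b/3, and 4b/3 >= b + 4 is the bound \<open>12 \<le> b\<close>.
      Each lower power of \<open>M\<close> now contributes at most half of the next.\<close>
    then have "b + 4 \<le> 2 * j" using assms(2) by linarith
    moreover have Suc: "Suc b = b + 1" "Suc (b+1) = b + 2" "Suc (b+2) = b + 3" "Suc (b+3) = b + 4"
      by simp_all
    ultimately have h: "2 * bcoeff b j \<le> bcoeff (b+1) j" "2 * bcoeff (b+1) j \<le> bcoeff (b+2) j" "2 * bcoeff (b+2) j \<le> bcoeff (b+3) j" "2 * bcoeff (b+3) j \<le> bcoeff (b+4) j"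
      using bcoeff_half[of b j] bcoeff_half[of "b+1" j] bcoeff_half[of "b+2" j] bcoeff_half[of "b+3" j]
      unfolding Suc by linarith+
    \<comment> \<open>The worst case is \<open>d = 0\<close>. Halving repeatedly, the weights -5,
      -12, -6, 4, 3 still leave more than one copy of the last coefficient.\<close>
    have "-5 * bcoeff b j \<le> (real d-5) * bcoeff b j" "-12 * bcoeff (b+1) j \<le> 4 * (real d-3) * bcoeff (b+1) j"
      "-6 * bcoeff (b+2) j \<le> 6 * (real d-1) * bcoeff (b+2) j" "4 * bcoeff (b+3) j \<le> 4 * (real d+1) * bcoeff (b+3) j" "3 * bcoeff (b+4) j \<le> (real d+3) * bcoeff (b+4) j"
      by (intro mult_right_mono nonneg; simp)+
    then show ?thesis unfolding mcoeff_4_diff[OF D] using h nonneg by linarith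
  qed
qed

text \<open>Since D <= -1, only the last summand can be positive, with weight at most 2. Passing
  from \<open>j\<close> to \<open>Suc j\<close> costs 4/3, and 2 * (4/3) / 16 = 1/6.\<close>

lemma mcoeff_4_near_peak:
  assumes "2 * (b + 4) \<le> 3 * Suc j" "20 \<le> j" "3 * Suc j \<le> 2 * (b + 4) + 7"
  shows "mcoeff 4 b (Suc j) - mcoeff 4 b j \<le> bcoeff (b+4) (Suc j) / (6 * real (Suc j))"
proof -
  define D where D: "D = 2 * real (b + 4) - 3 * real (Suc j) - 1"
  have "real (2 * (b + 4)) \<le> real (3 * Suc j)" using assms(1) by (simp only: of_nat_le_iff)
  then have D1: "D \<le> -1" unfolding D by simp
  note nonneg = bcoeff_nonneg[of b j] bcoeff_nonneg[of "b+1" j] bcoeff_nonneg[of "b+2" j] bcoeff_nonneg[of "b+3" j] bcoeff_nonneg[of "b+4" j]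
  have "(D-5) * bcoeff b j \<le> 0" "4 * (D-3) * bcoeff (b+1) j \<le> 0"
      "6 * (D-1) * bcoeff (b+2) j \<le> 0" "4 * (D+1) * bcoeff (b+3) j \<le> 0" "(D+3) * bcoeff (b+4) j \<le> 2 * bcoeff (b+4) j"
    using nonneg D1 by (auto intro!: mult_nonpos_nonneg mult_right_mono)
  then have "16 * (real (Suc j) * (mcoeff 4 b (Suc j) - mcoeff 4 b j)) \<le> 2 * bcoeff (b+4) j"
    unfolding mcoeff_4_diff[OF D] by linarith
  also have "\<dots> \<le> 2 * (4/3 * bcoeff (b+4) (Suc j))"
    using bcoeff_near_peak(1)[of "b+4" "Suc j"] assms by simp
  finally show ?thesis by (simp add: field_simps)
qed

section \<open>Large k: comparing the increments\<close>

text \<open>The linear factor bounds 96i for every index \<open>i\<close> of the ascent, as 3i <= 4k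
  + 2r + 5 <= 4k + 9. At k = 29 it equals 4000, which \<open>(3/4) ^ 29\<close> just
  outweighs.\<close>

lemma exp_beats_linear: "29 \<le> k \<Longrightarrow> (128 * real k + 288) * (3/4) ^ k \<le> 1"
proof (induction k rule: dec_induct)
  case base
  show ?case by (simp add: power_divide)
next
  case (step k)
  have "(128 * real (Suc k) + 288) * (3/4) ^ Suc k = (128 * real (Suc k) + 288) * (3/4) * (3/4) ^ k"
    by simp
  also have "\<dots> \<le> (128 * real k + 288) * (3/4) ^ k"
    using step by (intro mult_right_mono) auto
  also have "\<dots> \<le> 1" by (rule step.IH)
  finally show ?case .
qed

lemma coeff_H_up:
  assumes "29 \<le> k" "r \<le> 2" "3 * i + 1 \<le> 2 * (2*k+r+3)"
  shows "coeff (H k r) i \<le> coeff (H k r) (Suc i)"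
proof -
  define N where "N = 2*k+r+3"
  define \<epsilon> where "\<epsilon> = (3/4 :: real) ^ k * bcoeff N (i - 1)"
  have i: "3 * i + 1 \<le> 2 * N" using assms by (simp add: N_def)
  have Q: "bcoeff N i \<le> bcoeff N (Suc i)" using i by (intro bcoeff_mono) auto
  have up: "scoeff e a b i - \<epsilon> \<le> scoeff e a b (Suc i)" if "a + b = N" "k \<le> a" "1 \<le> e" for e a b
    unfolding \<epsilon>_def by (rule scoeff_up[OF that i])
  \<comment> \<open>The increment of the second term alone pays for all six errors: it is at least
    \<open>bcoeff N (i - 1)\<close> divided by 16i, and 96 = 6 * 16.\<close>
  have "6 * \<epsilon> \<le> scoeff 1 4 (2*k+r-1) (Suc i) - scoeff 1 4 (2*k+r-1) i" if "0 < i"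
  proof -
    obtain j where j: "i = Suc j" using \<open>0 < i\<close> by (cases i) auto
    define b where "b = 2*k+r-1"
    have N: "N = b + 4" using assms by (simp add: N_def b_def)
    have "real (3 * i + 1) \<le> real (2 * N)" using i by (simp only: of_nat_le_iff)
    then have "96 * real i \<le> 128 * real k + 288" using assms(2) by (simp add: N_def)
    then have "96 * real i * (3/4) ^ k \<le> (128 * real k + 288) * (3/4) ^ k"
      by (intro mult_right_mono) auto
    also have "\<dots> \<le> 1" using assms(1) by (rule exp_beats_linear)
    finally have "(96 * real i * (3/4) ^ k) * bcoeff N j \<le> 1 * bcoeff N j"
      by (intro mult_right_mono bcoeff_nonneg)
    also have "1 * bcoeff N j \<le> 16 * (real i * (mcoeff 4 b i - mcoeff 4 b j))"
      using mcoeff_4_up[of j b] i assms by (simp add: N j b_def)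
    finally have "real i * (6 * \<epsilon>) \<le> real i * (mcoeff 4 b i - mcoeff 4 b j)"
      by (simp add: \<epsilon>_def j algebra_simps)
    then show ?thesis using that by (simp add: scoeff_def b_def j)
  qed
  then have "real_of_int (coeff (H k r) i) \<le> real_of_int (coeff (H k r) (Suc i))"
  \<comment> \<open>At index 0 all shifted terms vanish, so they can only grow and no error has to
    be paid.\<close>
  proof (cases "i = 0")
    case True
    have "scoeff e a b 0 \<le> scoeff e a b (Suc 0)" if "1 \<le> e" for e a b
      using that by (simp add: scoeff_def mcoeff_nonneg)
    then show ?thesis
      using Q assms unfolding True by (simp add: coeff_H N_def add_mono)
  next
    case False
    assume "0 < i \<Longrightarrow> 6 * \<epsilon> \<le> scoeff 1 4 (2*k+r-1) (Suc i) - scoeff 1 4 (2*k+r-1) i"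
    then show ?thesis
      using Q False up[of "k+r" "k+3" 1] up[of k "k+r+3" 1] up[of "k+r+4" "k-1" 2] up[of "k+3" "k+r" 2]
        up[of "2*k+r" 3 2] up[of "2*k+r+3" 0 3] assms
      by (simp add: coeff_H N_def)
  qed
  then show ?thesis by simp
qed

lemma coeff_H_down:
  assumes "29 \<le> k" "r \<le> 2" "2 * (2*k+r+3) \<le> 3 * i"
  shows "coeff (H k r) (Suc i) \<le> coeff (H k r) i"
proof -
  define N where "N = 2*k+r+3"
  define b where "b = 2*k+r-1"
  have N: "N = b + 4" using assms by (simp add: N_def b_def)
  have i: "2 * N \<le> 3 * i" using assms by (simp add: N_def)
  \<comment> \<open>The bound is 21 so that \<open>i - 1\<close> still satisfies the bound 20 of
    \<open>mcoeff_4_near_peak\<close>.\<close>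
  have i20: "21 \<le> i" using assms by simp
  have "real_of_int (coeff (H k r) (Suc i)) \<le> real_of_int (coeff (H k r) i)"
  proof (cases "2 * N + 8 \<le> 3 * i")
    case True
    have down: "scoeff e a b (Suc i) \<le> scoeff e a b i" if "a + b = N" "e \<le> 3" for e a b
      using that True by (intro scoeff_down) (auto simp: N_def)
    have "mcoeff 0 N (Suc i) \<le> mcoeff 0 N i" using i by (intro mcoeff_down) simp
    then show ?thesis
      using down[of 4 "2*k+r-1" 1] down[of "k+r" "k+3" 1] down[of k "k+r+3" 1] down[of "k+r+4" "k-1" 2]
        down[of "k+3" "k+r" 2] down[of "2*k+r" 3 2] down[of "2*k+r+3" 0 3] assms
      by (simp add: coeff_H N_def mcoeff_0)
  next
    case False
    define \<epsilon> where "\<epsilon> = 2 * (3/4 :: real) ^ k * bcoeff N i"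
    have near: "scoeff e a b (Suc i) \<le> scoeff e a b i + \<epsilon>" if "a + b = N" "k \<le> a" "1 \<le> e" "e \<le> 3" for e a b
      unfolding \<epsilon>_def using that False i i20 by (intro scoeff_near_peak) auto
    \<comment> \<open>The budget is counted in units of \<open>X\<close>: \<open>M ^ N\<close> falls
      by at least 2X, the second term rises by at most X, and the six errors together amount to at
      most X.\<close>
    define X where "X = bcoeff N i / (2 * real (Suc i))"
    obtain j where j: "i = Suc j" using i20 by (cases i) auto
    have "real (2 * N) \<le> real (3 * i)" using i by (simp only: of_nat_le_iff)
    then have "real (Suc i) * (bcoeff N (Suc i) - bcoeff N i) \<le> (-1) * bcoeff N i"
      unfolding bcoeff_diff by (intro mult_right_mono bcoeff_nonneg) simp
    then have Q: "bcoeff N (Suc i) - bcoeff N i \<le> - (2 * X)"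
      by (simp add: X_def field_simps)
    have "scoeff 1 4 b (Suc i) - scoeff 1 4 b i \<le> bcoeff N i / (6 * real i)"
      using mcoeff_4_near_peak[of b j] i i20 False by (simp add: N j scoeff_def)
    also have "\<dots> \<le> X"
      unfolding X_def using i20 by (intro divide_left_mono bcoeff_nonneg) auto
    finally have C: "scoeff 1 4 b (Suc i) - scoeff 1 4 b i \<le> X" .
    have "real (3 * i) \<le> real (2 * N + 7)" using False unfolding of_nat_le_iff by simp
    then have "24 * real (Suc i) \<le> 128 * real k + 288" using assms(2) by (simp add: N_def)
    then have "24 * real (Suc i) * (3/4) ^ k \<le> (128 * real k + 288) * (3/4) ^ k"
      by (intro mult_right_mono) auto
    also have "\<dots> \<le> 1" using assms(1) by (rule exp_beats_linear)
    finally have "(24 * real (Suc i) * (3/4) ^ k) * bcoeff N i \<le> 1 * bcoeff N i"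
      by (intro mult_right_mono bcoeff_nonneg)
    then have "6 * \<epsilon> \<le> X"
      by (simp add: \<epsilon>_def X_def field_simps)
    then have "bcoeff N (Suc i) - bcoeff N i + (scoeff 1 4 b (Suc i) - scoeff 1 4 b i) + 6 * \<epsilon> \<le> 0"
      using Q C by linarith
    then show ?thesis
      using near[of "k+r" "k+3" 1] near[of k "k+r+3" 1] near[of "k+r+4" "k-1" 2] near[of "k+3" "k+r" 2]
        near[of "2*k+r" 3 2] near[of "2*k+r+3" 0 3] assms
      by (simp add: coeff_H N_def b_def)
  qed
  then show ?thesis by simp
qed

text \<open>The descent continues through the zero coefficients past the degree, so neither the
  degree nor trailing zeros of a coefficient list matter.\<close>

definition peaked_at :: "int poly \<Rightarrow> nat \<Rightarrow> bool" where
  "peaked_at p m \<longleftrightarrow> (\<forall>i<m. coeff p i \<le> coeff p (Suc i)) \<and> (\<forall>i\<ge>m. coeff p (Suc i) \<le> coeff p i)"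

text \<open>With N = 2k + r + 3 the mode m is the ceiling of 2N/3, so i < m means 3i + 1 <= 2N and i
  >= m means 2N <= 3i.\<close>

lemma peaked_at_H_large:
  assumes "29 \<le> k" "r \<le> 2"
  shows "peaked_at (H k r) ((4 * k + 2 * r + 8) div 3)"
  unfolding peaked_at_def using assms by (auto intro!: coeff_H_up coeff_H_down)

subsection \<open>Computation for small parameters\<close>

text \<open>Multiplication by 1 + cx in one pass; \<open>a\<close> carries the preceding coefficient
  and is 0 at the start.\<close>

fun lin :: "int \<Rightarrow> int \<Rightarrow> int list \<Rightarrow> int list" where
  "lin c a [] = [c * a]"
| "lin c a (x # xs) = (x + c * a) # lin c x xs"

lemma Poly_lin: "Poly (lin c a xs) = [:c * a:] + [:1, c:] * Poly xs"
  by (induction xs arbitrary: a) (simp_all add: algebra_simps)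

fun lins :: "int \<Rightarrow> nat \<Rightarrow> int list \<Rightarrow> int list" where
  "lins c 0 xs = xs"
| "lins c (Suc n) xs = lins c n (lin c 0 xs)"

lemma Poly_lins: "Poly (lins c n xs) = [:1, c:] ^ n * Poly xs"
proof (induction n arbitrary: xs)
  case 0
  show ?case by simp
next
  case (Suc n)
  have "Poly (lin c 0 xs) = [:1, c:] * Poly xs" by (simp only: Poly_lin) simp
  then show ?case by (simp only: lins.simps Suc power_Suc mult_ac)
qed

fun add :: "int list \<Rightarrow> int list \<Rightarrow> int list" where
  "add [] ys = ys"
| "add (x # xs) [] = x # xs"
| "add (x # xs) (y # ys) = (x + y) # add xs ys"

lemma Poly_add: "Poly (add xs ys) = Poly xs + Poly ys"
  by (induction xs ys rule: add.induct) simp_all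

text \<open>The clause for \<open>[x]\<close> is the last descent, to the zero that follows the
  list. A list too short to contain index \<open>m\<close> is rejected.\<close>

fun peak :: "nat \<Rightarrow> int list \<Rightarrow> bool" where
  "peak (Suc m) (x # y # ys) \<longleftrightarrow> x \<le> y \<and> peak m (y # ys)"
| "peak 0 (x # y # ys) \<longleftrightarrow> y \<le> x \<and> peak 0 (y # ys)"
| "peak 0 [x] \<longleftrightarrow> 0 \<le> x"
| "peak _ _ \<longleftrightarrow> False"

lemma peaked_at_Poly:
  assumes "peak m xs"
  shows "peaked_at (Poly xs) m"
proof -
  have "(i < m \<longrightarrow> coeff (Poly xs) i \<le> coeff (Poly xs) (Suc i)) \<and>
      (m \<le> i \<longrightarrow> coeff (Poly xs) (Suc i) \<le> coeff (Poly xs) i)" for i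
    using assms
    by (induction m xs arbitrary: i rule: peak.induct) (auto simp: coeff_pCons split: nat.splits)
  then show ?thesis by (simp add: peaked_at_def)
qed

text \<open>From \<open>k\<close> to \<open>k + 1\<close> the three groups of terms of \<open>H\<close> are multiplied by
  \<open>M\<^sup>2\<close>, \<open>L M\<close> and \<open>L\<^sup>2\<close>.\<close>

fun peaks :: "nat \<Rightarrow> nat \<Rightarrow> nat \<Rightarrow> int list \<Rightarrow> int list \<Rightarrow> int list \<Rightarrow> bool" where
  "peaks r k 0 U V W \<longleftrightarrow> True"
| "peaks r k (Suc n) U V W \<longleftrightarrow> peak ((4 * k + 2 * r + 8) div 3) (add U (add V W)) \<and>
     peaks r (Suc k) n (lin 2 0 (lin 2 0 U)) (lin 1 0 (lin 2 0 V)) (lin 1 0 (lin 1 0 W))"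

text \<open>The equations for \<open>U\<close>, \<open>V\<close>, \<open>W\<close> are the loop
  invariant at k = l + 1. They split H by whether neither, one or both of its factors contribute the
  summand with a k-dependent power of \<open>L\<close>. Writing \<open>l\<close> for k - 1 avoids
  truncated subtraction.\<close>

lemma peaked_at_H_if_peaks:
  assumes "peaks r (Suc l) n U V W"
    and "Poly U = F 4 * M ^ (2 * l + 1 + r)"
    and "Poly V = [:0, 1:] * (F 4 * M ^ l * L ^ (Suc l + r) + F 3 * M ^ (Suc l + r) * L ^ Suc l)"
    and "Poly W = [:0, 1:] * [:0, 1:] * F 3 * L ^ (2 * Suc l + r)"
    and "l < k" "k \<le> l + n"
  shows "peaked_at (H k r) ((4 * k + 2 * r + 8) div 3)"
  using assms
proof (induction n arbitrary: l U V W)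
  case 0
  then show ?case by simp
next
  case (Suc n)
  show ?case
  proof (cases "k = Suc l")
    case True
    have "(A * p ^ l + x * q ^ Suc l * B) * (p ^ (Suc l + r) + x * q ^ (Suc l + r)) =
        A * p ^ (2 * l + 1 + r) + (x * (A * p ^ l * q ^ (Suc l + r) + B * p ^ (Suc l + r) * q ^ Suc l) +
        x * x * B * q ^ (2 * Suc l + r))" for A B p q x :: "int poly"
      by (simp add: power_add power_mult power2_eq_square mult_2 algebra_simps)
    then have "Poly (add U (add V W)) = H k r"
      unfolding Poly_add Suc.prems H_def G_def True F_def[of "Suc l + r"] diff_Suc_1 by (rule sym)
    then show ?thesis using Suc.prems(1) peaked_at_Poly True by (metis peaks.simps(2))
  next
    case False
    have lin: "Poly (lin c 0 xs) = [:1, c:] * Poly xs" for c xs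
      by (simp only: Poly_lin) simp
    show ?thesis
    proof (rule Suc.IH)
      show "peaks r (Suc (Suc l)) n (lin 2 0 (lin 2 0 U)) (lin 1 0 (lin 2 0 V)) (lin 1 0 (lin 1 0 W))"
        using Suc.prems(1) by simp
      have "2 * Suc l + 1 + r = Suc (Suc (2 * l + 1 + r))" by simp
      then show "Poly (lin 2 0 (lin 2 0 U)) = F 4 * M ^ (2 * Suc l + 1 + r)"
        by (simp only: lin Suc.prems power_Suc mult_ac)
      have "2 * Suc (Suc l) + r = Suc (Suc (2 * Suc l + r))" by simp
      then show "Poly (lin 1 0 (lin 1 0 W)) = [:0, 1:] * [:0, 1:] * F 3 * L ^ (2 * Suc (Suc l) + r)"
        by (simp only: lin Suc.prems power_Suc mult_ac)
      show "Poly (lin 1 0 (lin 2 0 V)) = [:0, 1:] * (F 4 * M ^ Suc l * L ^ (Suc (Suc l) + r) +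
          F 3 * M ^ (Suc (Suc l) + r) * L ^ Suc (Suc l))"
        by (simp only: lin Suc.prems power_Suc add_Suc distrib_left mult_ac)
    qed (use Suc.prems False in auto)
  qed
qed

lemma F_3: "F 3 = Poly [1, 7, 15, 11, 1]"
  and F_4: "F 4 = Poly [1, 9, 28, 38, 20, 1]"
  by (simp_all add: F_def eval_nat_numeral)

definition peaks_from :: "nat \<Rightarrow> nat \<Rightarrow> nat \<Rightarrow> bool" where
  "peaks_from r l n \<longleftrightarrow> peaks r (Suc l) n
     (lins 2 (2 * l + 1 + r) [1, 9, 28, 38, 20, 1])
     (0 # add (lins 1 (Suc l + r) (lins 2 l [1, 9, 28, 38, 20, 1]))
              (lins 1 (Suc l) (lins 2 (Suc l + r) [1, 7, 15, 11, 1])))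
     (0 # 0 # lins 1 (2 * Suc l + r) [1, 7, 15, 11, 1])"

lemma peaked_at_H_small:
  assumes "peaks_from r l n" "l < k" "k \<le> l + n"
  shows "peaked_at (H k r) ((4 * k + 2 * r + 8) div 3)"
proof (rule peaked_at_H_if_peaks[OF assms(1)[unfolded peaks_from_def] _ _ _ assms(2,3)])
  have x: "Poly (0 # xs) = [:0, 1:] * Poly xs" for xs :: "int list" by simp
  show "Poly (lins 2 (2 * l + 1 + r) [1, 9, 28, 38, 20, 1]) = F 4 * M ^ (2 * l + 1 + r)"
    by (simp only: Poly_lins F_4 mult_ac)
  show "Poly (0 # add (lins 1 (Suc l + r) (lins 2 l [1, 9, 28, 38, 20, 1]))
              (lins 1 (Suc l) (lins 2 (Suc l + r) [1, 7, 15, 11, 1]))) =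
     [:0, 1:] * (F 4 * M ^ l * L ^ (Suc l + r) + F 3 * M ^ (Suc l + r) * L ^ Suc l)"
    by (simp only: x Poly_add Poly_lins F_3 F_4 mult_ac)
  show "Poly (0 # 0 # lins 1 (2 * Suc l + r) [1, 7, 15, 11, 1]) =
     [:0, 1:] * [:0, 1:] * F 3 * L ^ (2 * Suc l + r)"
    by (simp only: x Poly_lins F_3 mult_ac)
qed

text \<open>This and the next two evaluations cover every admissible k up to 28: from 3 on for r = 0
  and r = 1, from 4 on for r = 2.\<close>

lemma peaks_from_0: "peaks_from 0 2 26"
  by code_simp

lemma peaks_from_1: "peaks_from 1 2 26"
  by code_simp

lemma peaks_from_2: "peaks_from 2 3 25"
  by code_simp

section \<open>All admissible k, and unimodality\<close>

lemma peaked_at_H: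
  assumes "r \<in> {0, 1, 2}" "k \<ge> 3" "r = 2 \<Longrightarrow> k \<ge> 4"
  shows "peaked_at (H k r) ((4 * k + 2 * r + 8) div 3)"
proof (cases "29 \<le> k")
  case True
  then show ?thesis using assms by (intro peaked_at_H_large) auto
next
  case False
  have "\<exists>l n. peaks_from r l n \<and> l < k \<and> k \<le> l + n"
  proof (cases "r = 2")
    case True
    then show ?thesis using peaks_from_2 False assms(3) by (intro exI[of _ 3] exI[of _ 25]) auto
  next
    case r: False
    then have "peaks_from r 2 26" using assms(1) peaks_from_0 peaks_from_1 by auto
    then show ?thesis using False assms(2) by (intro exI[of _ 2] exI[of _ 26]) auto
  qed
  then show ?thesis using peaked_at_H_small by blast
qed

lemma coeff_H_nonneg:
  assumes "k \<ge> 1"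
  shows "0 \<le> coeff (H k r) i" "1 \<le> coeff (H k r) 0"
proof -
  have s: "0 \<le> scoeff e a b i" for e a b i by (simp add: scoeff_def mcoeff_nonneg)
  have "0 \<le> real_of_int (coeff (H k r) i)"
    unfolding coeff_H[OF assms] by (intro add_nonneg_nonneg s bcoeff_nonneg)
  then show "0 \<le> coeff (H k r) i" by simp
  have "bcoeff (2*k+r+3) 0 = 1" by (simp add: bcoeff_def)
  then have "1 \<le> real_of_int (coeff (H k r) 0)"
    unfolding coeff_H[OF assms] by (simp add: add_increasing2 s)
  then show "1 \<le> coeff (H k r) 0" by simp
qed

theorem theorem4p8:
  fixes k r :: nat
  assumes "r \<in> {0, 1, 2}"
    and "k \<ge> 3"
    and "r = 2 \<Longrightarrow> k \<ge> 4"
  shows "unimodal_with_mode (H k r) ((4 * k + 2 * r + 8) div 3)"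
proof -
  define m where "m = (4 * k + 2 * r + 8) div 3"
  have peak: "peaked_at (H k r) m"
    unfolding m_def using assms by (rule peaked_at_H)
  have nonneg: "0 \<le> coeff (H k r) i" and "1 \<le> coeff (H k r) 0" for i
    using coeff_H_nonneg assms(2) by auto
  \<comment> \<open>Climbing from the constant term makes the coefficient at \<open>m\<close>
    positive, which puts \<open>m\<close> within the degree.\<close>
  moreover have "coeff (H k r) 0 \<le> coeff (H k r) i" if "i \<le> m" for i
    using that
  proof (induction i)
    case (Suc i)
    then have "coeff (H k r) i \<le> coeff (H k r) (Suc i)"
      using peak unfolding peaked_at_def by simp
    with Suc show ?case by simp
  qed simp
  ultimately have "1 \<le> coeff (H k r) m" by (meson order.trans order.refl)
  then have "m \<le> degree (H k r)" by (intro le_degree) simp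
  then show ?thesis
    using peak nonneg unfolding unimodal_with_mode_def peaked_at_def m_def[symmetric] by blast
qed

end
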